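(* Let $f_1,\dots,f_N:\mathbb{R}^n\to\mathbb{R}^n$ be contracting similitudes with contraction factors $r_1,\dots,r_N\in(0,1)$, and let $K$ be their invariant set. Suppose $K$ is a self-similar tile in $n$-dimensional Euclidean space $\mathbb{R}^n$ and that the similarity dimension is $n$. If the similarity boundary $\partial_sK$ is inverse invariant, then $\partial_sK=\partial K$, where $\partial K$ is the topological boundary of $K$ in $\mathbb{R}^n$.
   Context: A contracting similitude with contraction factor $r\in(0,1)$ is a map $f$ with $|f(x)-f(y)|=r|x-y|$ for all $x,y$. The invariant set (self-similar set) $K$ is the unique non-empty compact set with $K=\bigcup_{i=1}^N f_i(K)$. $K$ being a self-similar tile means here that $K$ has non-empty interior in $\mathbb{R}^n$. The similarity dimension is the unique real $\alpha$ with $\sum_{i=1}^N r_i^{\alpha}=1$; the assumption is $\alpha=n$. The similarity boundary is $\partial_sK=\bigcup_{j\neq k} f_j^{-1}\big(f_j(K)\cap f_k(K)\big)$, the union over all ordered pairs $(j,k)$ with $j\neq k$. It is called inverse invariant if $f_i^{-1}(\partial_sK)\cap K\subseteq\partial_sK$ for all $i=1,\dots,N$. *)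

theory Defs
  imports "HOL-Analysis.Analysis"
begin

definition contracting_similitude :: "real \<Rightarrow> ('a::metric_space \<Rightarrow> 'a) \<Rightarrow> bool" where
  "contracting_similitude r f \<longleftrightarrow> 0 < r \<and> r < 1 \<and> (\<forall>x y. dist (f x) (f y) = r * dist x y)"

text \<open>
  For contracting similitudes of a complete space there is exactly one such set \<open>K\<close>
  when \<open>N \<ge> 1\<close> (Hutchinson). For \<open>N = 0\<close> there is none, since the union is then empty.
\<close>

definition is_invariant_set :: "nat \<Rightarrow> (nat \<Rightarrow> 'a::metric_space \<Rightarrow> 'a) \<Rightarrow> 'a set \<Rightarrow> bool" where
  "is_invariant_set N f K \<longleftrightarrow> K \<noteq> {} \<and> compact K \<and> K = (\<Union>i\<in>{1..N}. f i ` K)"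

text \<open>
  The description is proper whenever \<open>N \<ge> 1\<close> and all ratios lie strictly between 0 and 1:
  the sum is then continuous and strictly decreasing in \<open>\<alpha>\<close>, with range the positive reals.
\<close>

definition similarity_dimension :: "nat \<Rightarrow> (nat \<Rightarrow> real) \<Rightarrow> real" where
  "similarity_dimension N r = (THE \<alpha>. (\<Sum>i=1..N. r i powr \<alpha>) = 1)"

definition similarity_boundary :: "nat \<Rightarrow> (nat \<Rightarrow> 'a \<Rightarrow> 'a) \<Rightarrow> 'a set \<Rightarrow> 'a set" where
  "similarity_boundary N f K =
     (\<Union>j\<in>{1..N}. \<Union>k\<in>{1..N} - {j}. f j -` (f j ` K \<inter> f k ` K))"

definition inverse_invariant :: "nat \<Rightarrow> (nat \<Rightarrow> 'a \<Rightarrow> 'a) \<Rightarrow> 'a set \<Rightarrow> 'a set \<Rightarrow> bool" where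
  "inverse_invariant N f K B \<longleftrightarrow> (\<forall>i\<in>{1..N}. f i -` B \<inter> K \<subseteq> B)"

end

theory Submission
  imports Defs
begin

text \<open>
  For a similarity dimension equal to \<open>n\<close> the pieces \<open>f\<^sub>i(K)\<close> have total volume at most that
  of their union \<open>K\<close>, so they cannot overlap in an open set; as \<open>K\<close> is the closure of its
  interior, this forces \<open>f\<^sub>j(int K)\<close> to miss \<open>f\<^sub>k(K)\<close>, and the similarity boundary
  lies in the topological one. Conversely, inverse invariance makes the set \<open>S\<close> of topological
  boundary points outside the similarity boundary forward invariant under every \<open>f\<^sub>i\<close>: a
  point \<open>f\<^sub>i(x)\<close> lying in no other piece is interior to \<open>K\<close> only if \<open>x\<close> is. A
  nonempty forward invariant set is dense in \<open>K\<close>, so \<open>S \<noteq> {}\<close> would make the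
  closed set \<open>\<partial>K\<close> contain \<open>K\<close>, contradicting that \<open>K\<close> has interior points.
\<close>

section \<open>Volume of Lipschitz images\<close>

text \<open>
  The library's change of variables formulas require the index type of \<open>real ^ 'n\<close> to be
  well-ordered, which is why a Vitali covering by balls is used instead.
\<close>

lemma measure_lipschitz_image_le:
  fixes f :: "'a::euclidean_space \<Rightarrow> 'a"
  assumes lip: "c-lipschitz_on UNIV f"
    and S: "S \<in> lmeasurable" and fS: "f ` S \<in> sets lebesgue"
  shows "measure lebesgue (f ` S) \<le> c ^ DIM('a) * measure lebesgue S"
proof -
  have c: "0 \<le> c"
    using lip lipschitz_on_nonneg by blast
  \<comment> \<open>The slack \<open>e\<close> pays for replacing \<open>S\<close> by an open
    \<open>U\<close> containing it; it goes to 0 at the end.\<close>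
  have *: "measure lebesgue (f ` S) \<le> c ^ DIM('a) * (measure lebesgue S + e)" if "e > 0" for e
  proof -
    obtain U where U: "open U" "S \<subseteq> U" "U - S \<in> lmeasurable" "emeasure lebesgue (U - S) < ennreal e"
      using sets_lebesgue_outer_open[OF _ \<open>e > 0\<close>] S by (metis fmeasurableD)
    have Um: "U \<in> lmeasurable"
      using fmeasurable.Un[OF S U(3)] U(2) by (simp add: Un_absorb1)
    have "measure lebesgue (U - S) < e"
      using U(3,4) \<open>e > 0\<close> by (metis emeasure_eq_measure2 ennreal_less_iff measure_nonneg)
    then have Ue: "measure lebesgue U \<le> measure lebesgue S + e"
      using measurable_measure_Diff[OF Um fmeasurableD[OF S] U(2)] by simp
    \<comment> \<open>A pair holds a centre and a radius. Keeping the balls inside \<open>U\<close>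
      lets a disjoint subfamily have total volume at most that of \<open>U\<close>.\<close>
    let ?I = "{p::'a \<times> real. 0 < snd p \<and> ball (fst p) (snd p) \<subseteq> U}"
    have cover: "\<exists>p. p \<in> ?I \<and> x \<in> ball (fst p) (snd p) \<and> snd p < d" if "x \<in> S" "0 < d" for x d
    proof -
      obtain s where "s > 0" "ball x s \<subseteq> U"
        using U(1,2) \<open>x \<in> S\<close> by (metis openE subsetD)
      then show ?thesis
        using \<open>0 < d\<close> by (intro exI[of _ "(x, min s (d/2))"]) auto
    qed
    obtain C where C: "countable C" "C \<subseteq> ?I"
      and disj: "pairwise (\<lambda>p q. disjnt (ball (fst p) (snd p)) (ball (fst q) (snd q))) C"
      and neg: "negligible (S - (\<Union>p\<in>C. ball (fst p) (snd p)))"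
      by (rule Vitali_covering_theorem_balls[where S = S and K = ?I and a = fst and r = snd, OF cover]) blast+
    \<comment> \<open>Closed balls still contain the images of the source balls when
      \<open>c = 0\<close>.\<close>
    let ?D = "\<lambda>p. cball (f (fst p)) (c * snd p)"
    have bound: "measure lebesgue (\<Union>p\<in>F. ?D p) \<le> c ^ DIM('a) * measure lebesgue U"
      if F: "F \<subseteq> C" "finite F" for F
    proof -
      have "measure lebesgue (\<Union>p\<in>F. ?D p) \<le> (\<Sum>p\<in>F. measure lebesgue (?D p))"
        using F by (intro measure_UNION_le) auto
      also have "\<dots> = (\<Sum>p\<in>F. c ^ DIM('a) * measure lebesgue (ball (fst p) (snd p)))"
      proof (rule sum.cong)
        fix p assume "p \<in> F"
        then have "0 < snd p"
          using F C by auto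
        then show "measure lebesgue (?D p) = c ^ DIM('a) * measure lebesgue (ball (fst p) (snd p))"
          using c by (simp add: content_cball content_ball power_mult_distrib)
      qed simp
      also have "\<dots> = c ^ DIM('a) * measure lebesgue (\<Union>p\<in>F. ball (fst p) (snd p))"
        using F disj by (subst measure_UNION') (auto simp: sum_distrib_left intro: pairwise_subset)
      also have "\<dots> \<le> c ^ DIM('a) * measure lebesgue U"
        using F C c Um by (intro mult_left_mono measure_mono_fmeasurable) (auto intro!: sets.finite_UN)
      finally show ?thesis .
    qed
    have Dm: "(\<Union>p\<in>C. ?D p) \<in> lmeasurable" "measure lebesgue (\<Union>p\<in>C. ?D p) \<le> c ^ DIM('a) * measure lebesgue U"
      by (rule fmeasurable_UN_bound[OF C(1) _ bound] measure_UN_bound[OF C(1) _ bound]; simp)+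
    let ?N = "f ` (S - (\<Union>p\<in>C. ball (fst p) (snd p)))"
    \<comment> \<open>The points missed by the Vitali family are negligible, and a Lipschitz map
      preserves this.\<close>
    have "negligible ?N"
    proof (rule negligible_locally_Lipschitz_image[OF _ neg])
      fix x
      show "\<exists>T B. open T \<and> x \<in> T \<and>
          (\<forall>y\<in>(S - (\<Union>p\<in>C. ball (fst p) (snd p))) \<inter> T. norm (f y - f x) \<le> B * norm (y - x))"
        using lipschitz_onD[OF lip] by (intro exI[of _ UNIV] exI[of _ c]) (auto simp: dist_norm)
    qed simp
    then have N: "?N \<in> lmeasurable" "measure lebesgue ?N = 0"
      by (auto simp: negligible_iff_measure)
    have "f ` ball (fst p) (snd p) \<subseteq> ?D p" for p
      using lipschitz_onD[OF lip] c
      by (auto simp: dist_commute) (meson UNIV_I less_imp_le mult_left_mono order_trans)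
    then have "f ` S \<subseteq> ?N \<union> (\<Union>p\<in>C. ?D p)"
      by blast
    then have "measure lebesgue (f ` S) \<le> measure lebesgue (?N \<union> (\<Union>p\<in>C. ?D p))"
      using fS N Dm by (intro measure_mono_fmeasurable) auto
    also have "\<dots> \<le> measure lebesgue ?N + measure lebesgue (\<Union>p\<in>C. ?D p)"
      using N Dm by (intro measure_Un_le) auto
    also have "\<dots> \<le> c ^ DIM('a) * measure lebesgue U"
      using N Dm by simp
    also have "\<dots> \<le> c ^ DIM('a) * (measure lebesgue S + e)"
      using Ue c by (intro mult_left_mono) auto
    finally show ?thesis .
  qed
  have "((\<lambda>e. c ^ DIM('a) * (measure lebesgue S + e)) \<longlongrightarrow> c ^ DIM('a) * (measure lebesgue S + 0)) (at_right 0)"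
    by (intro tendsto_intros)
  then show ?thesis
    using * by (intro tendsto_lowerbound[where F = "at_right 0"]) (auto simp: eventually_at_filter)
qed

section \<open>Contracting similitudes and their invariant sets\<close>

lemma contracting_similitude_lipschitz:
  "contracting_similitude c f \<Longrightarrow> c-lipschitz_on UNIV f"
  by (auto simp: contracting_similitude_def lipschitz_on_def)

lemma contracting_similitude_inj:
  assumes "contracting_similitude c f"
  shows "inj f"
  using assms unfolding contracting_similitude_def inj_def
  by (metis dist_eq_0_iff mult_eq_0_iff less_irrefl)

lemma contracting_similitude_continuous_on:
  assumes "contracting_similitude c f"
  shows "continuous_on S f"
  using lipschitz_on_continuous_on[OF contracting_similitude_lipschitz[OF assms]]
  by (rule continuous_on_subset) simp

lemma contracting_similitude_open_image:
  fixes f :: "'a::euclidean_space \<Rightarrow> 'a"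
  assumes "contracting_similitude c f" "open S"
  shows "open (f ` S)"
  using contracting_similitude_continuous_on[OF assms(1)] \<open>open S\<close>
    inj_on_subset[OF contracting_similitude_inj[OF assms(1)]]
  by (rule invariance_of_domain) simp

text \<open>The sum is continuous and strictly decreasing in the exponent, at least 1 at exponent 0
  and below 1 at some large integer, so the description in the definition picks a unique
  root.\<close>

lemma similarity_dimension_sum:
  fixes r :: "nat \<Rightarrow> real"
  assumes r: "\<And>i. i \<in> {1..N} \<Longrightarrow> 0 < r i \<and> r i < 1" and N: "N \<noteq> 0"
  shows "(\<Sum>i=1..N. r i powr similarity_dimension N r) = 1"
proof -
  let ?g = "\<lambda>\<alpha>. \<Sum>i=1..N. r i powr \<alpha>"
  have mono: "?g \<beta> < ?g \<alpha>" if "\<alpha> < \<beta>" for \<alpha> \<beta>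
    using that r N by (intro sum_strict_mono) (auto intro: powr_less_mono')
  have cont: "continuous_on A ?g" for A
  proof (intro continuous_intros ballI)
    show "r i \<noteq> 0" if "i \<in> {1..N}" for i
      using r[OF that] by simp
  qed
  have "(\<lambda>n. \<Sum>i=1..N. r i ^ n) \<longlonglongrightarrow> (\<Sum>i=1..N. 0)"
    using r by (intro tendsto_sum LIMSEQ_realpow_zero) (auto intro: less_imp_le)
  then have "eventually (\<lambda>n. (\<Sum>i=1..N. r i ^ n) < 1) sequentially"
    by (intro order_tendstoD) auto
  then obtain n where "(\<Sum>i=1..N. r i ^ n) < 1"
    by (auto simp: eventually_sequentially)
  moreover have "?g (real n) = (\<Sum>i=1..N. r i ^ n)"
    using r by (intro sum.cong) (auto simp: powr_realpow)
  ultimately obtain \<beta> where \<beta>: "?g \<beta> < 1" "\<beta> \<ge> 0"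
    by (metis of_nat_0_le_iff)
  have "?g 0 = (\<Sum>i=1..N. 1)"
    using r by (intro sum.cong) fastforce+
  then have "?g 0 \<ge> 1"
    using N by simp
  then obtain \<alpha> where \<alpha>: "?g \<alpha> = 1"
    using IVT2'[of ?g \<beta> 1 0, OF _ _ _ cont] \<beta> by auto
  have "\<beta> = \<alpha>" if "?g \<beta> = 1" for \<beta>
    using mono[of \<alpha> \<beta>] mono[of \<beta> \<alpha>] \<alpha> that by (cases \<alpha> \<beta> rule: linorder_cases) simp_all
  with \<alpha> show ?thesis
    unfolding similarity_dimension_def by (rule theI)
qed

text \<open>Take \<open>y\<close> in \<open>K\<close> farthest from \<open>T\<close> and write
  \<open>y = f i z\<close> with \<open>z\<close> in \<open>K\<close>. Since \<open>f i\<close>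
  shrinks the distance to \<open>T\<close> by at least the factor \<open>r i\<close>, the maximal
  distance is at most \<open>r i\<close> times itself, hence 0.\<close>

lemma invariant_set_subset_forward_invariant:
  assumes f: "\<And>i. i \<in> {1..N} \<Longrightarrow> contracting_similitude (r i) (f i)"
    and K: "is_invariant_set N f K"
    and T: "closed T" "T \<noteq> {}" "\<And>i. i \<in> {1..N} \<Longrightarrow> f i ` T \<subseteq> T"
  shows "K \<subseteq> T"
proof -
  have "compact K" "K \<noteq> {}" and Keq: "K = (\<Union>i\<in>{1..N}. f i ` K)"
    using K unfolding is_invariant_set_def by blast+
  then obtain y where y: "y \<in> K" and ymax: "\<And>z. z \<in> K \<Longrightarrow> infdist z T \<le> infdist y T"
    using continuous_attains_sup[OF _ _ continuous_on_infdist[OF continuous_on_id], of K T]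
    by blast
  obtain i z where i: "i \<in> {1..N}" and z: "z \<in> K" "y = f i z"
    using y Keq by blast
  have r: "0 < r i" "r i < 1" and d: "\<And>u v. dist (f i u) (f i v) = r i * dist u v"
    using f[OF i] by (auto simp: contracting_similitude_def)
  have "infdist y T / r i \<le> dist z t" if "t \<in> T" for t
  proof -
    have "infdist y T \<le> dist y (f i t)"
      using T(3)[OF i] that by (intro infdist_le) auto
    then show ?thesis
      using z d r by (simp add: field_simps)
  qed
  then have "infdist y T / r i \<le> infdist z T"
    unfolding infdist_def[of z] using T(2) by (auto intro: cINF_greatest)
  also have "\<dots> \<le> infdist y T"
    using ymax z by blast
  finally have "infdist y T * (1 - r i) \<le> 0"
    using r by (simp add: field_simps)
  then have "infdist y T \<le> 0"
    using r by (simp add: mult_le_0_iff)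
  then have "infdist z T = 0" if "z \<in> K" for z
    using ymax[OF that] infdist_nonneg[of z T] by linarith
  then show ?thesis
    using T in_closed_iff_infdist_zero by blast
qed

lemma invariant_set_image_subset:
  "is_invariant_set N f K \<Longrightarrow> i \<in> {1..N} \<Longrightarrow> f i ` K \<subseteq> K"
  unfolding is_invariant_set_def by blast

lemma invariant_set_image_interior_subset:
  fixes f :: "nat \<Rightarrow> 'a::euclidean_space \<Rightarrow> 'a"
  assumes "contracting_similitude c (f i)" "is_invariant_set N f K" "i \<in> {1..N}"
  shows "f i ` interior K \<subseteq> interior K"
proof (rule interior_maximal)
  show "f i ` interior K \<subseteq> K"
    using invariant_set_image_subset[OF assms(2,3)] interior_subset by blast
qed (use contracting_similitude_open_image assms in blast)

text \<open>The maps send the interior into itself, so its closure is a nonempty closed forward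
  invariant set.\<close>

lemma invariant_set_subset_closure_interior:
  fixes f :: "nat \<Rightarrow> 'a::euclidean_space \<Rightarrow> 'a"
  assumes f: "\<And>i. i \<in> {1..N} \<Longrightarrow> contracting_similitude (r i) (f i)"
    and K: "is_invariant_set N f K" and int: "interior K \<noteq> {}"
  shows "K \<subseteq> closure (interior K)"
proof (rule invariant_set_subset_forward_invariant[OF f K])
  fix i assume i: "i \<in> {1..N}"
  show "f i ` closure (interior K) \<subseteq> closure (interior K)"
    using invariant_set_image_interior_subset[OF f[OF i] K i] closure_subset[of "interior K"]
    by (intro image_closure_subset contracting_similitude_continuous_on[OF f[OF i]]) auto
qed (use int in auto)

section \<open>Overlaps of the pieces\<close>

lemma invariant_set_open_overlap_empty:
  fixes f :: "nat \<Rightarrow> 'a::euclidean_space \<Rightarrow> 'a"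
  assumes f: "\<And>i. i \<in> {1..N} \<Longrightarrow> contracting_similitude (r i) (f i)"
    and K: "is_invariant_set N f K"
    and dim: "similarity_dimension N r = real DIM('a)"
    and jk: "j \<in> {1..N}" "k \<in> {1..N}" "j \<noteq> k"
    and U: "open U" "U \<subseteq> f j ` K" "U \<subseteq> f k ` K"
  shows "U = {}"
proof (rule ccontr)
  assume "U \<noteq> {}"
  let ?\<mu> = "measure lebesgue"
  have "compact K" and Keq: "K = (\<Union>i\<in>{1..N}. f i ` K)"
    using K unfolding is_invariant_set_def by blast+
  have Km: "K \<in> lmeasurable"
    using \<open>compact K\<close> by (rule lmeasurable_compact)
  have im: "f i ` K \<in> lmeasurable" if "i \<in> {1..N}" for i
    using \<open>compact K\<close>
    by (intro lmeasurable_compact compact_continuous_image contracting_similitude_continuous_on[OF f[OF that]])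
  have Um: "U \<in> lmeasurable"
    using U \<open>compact K\<close> compact_imp_bounded bounded_subset invariant_set_image_subset[OF K jk(1)]
    by (meson lmeasurable_open)
  have Upos: "?\<mu> U > 0"
    using Um \<open>U \<noteq> {}\<close> \<open>open U\<close> open_not_negligible negligible_iff_measure
    by (metis measure_nonneg order_le_less)
  have r: "0 < r i \<and> r i < 1" if "i \<in> {1..N}" for i
    using f[OF that] by (simp add: contracting_similitude_def)
  have "(\<Sum>i=1..N. r i ^ DIM('a)) = (\<Sum>i=1..N. r i powr similarity_dimension N r)"
    using r by (intro sum.cong) (auto simp: dim powr_realpow)
  also have "\<dots> = 1"
    using jk(1) r by (intro similarity_dimension_sum) auto
  finally have sum1: "(\<Sum>i=1..N. r i ^ DIM('a)) = 1" .
  \<comment> \<open>Piece \<open>k\<close> still covers \<open>U\<close>, so removing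
    \<open>U\<close> from piece \<open>j\<close> keeps a cover of \<open>K\<close> while lowering
    the total volume by that of \<open>U\<close>.\<close>
  let ?A = "\<lambda>i. if i = j then f i ` K - U else f i ` K"
  have "K = (\<Union>i\<in>{1..N}. ?A i)"
  proof
    show "K \<subseteq> (\<Union>i\<in>{1..N}. ?A i)"
    proof
      fix x assume "x \<in> K"
      then obtain i where i: "i \<in> {1..N}" "x \<in> f i ` K"
        using Keq by blast
      show "x \<in> (\<Union>i\<in>{1..N}. ?A i)"
      proof (cases "x \<in> U")
        case True
        then show ?thesis
          using U(3) jk by (intro UN_I[of k]) auto
      qed (use i in auto)
    qed
    show "(\<Union>i\<in>{1..N}. ?A i) \<subseteq> K"
      using invariant_set_image_subset[OF K] by (fastforce split: if_splits)
  qed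
  then have "?\<mu> K = ?\<mu> (\<Union>i\<in>{1..N}. ?A i)"
    by simp
  also have "\<dots> \<le> (\<Sum>i=1..N. ?\<mu> (?A i))"
    using im Um by (intro measure_UNION_le) (auto intro!: sets.Diff fmeasurableD)
  also have "\<dots> = (\<Sum>i=1..N. ?\<mu> (f i ` K) - (if i = j then ?\<mu> U else 0))"
    using im[OF jk(1)] Um U(2) by (intro sum.cong) (auto simp: measurable_measure_Diff fmeasurableD)
  also have "\<dots> = (\<Sum>i=1..N. ?\<mu> (f i ` K)) - ?\<mu> U"
    using jk(1) by (simp add: sum_subtractf)
  also have "(\<Sum>i=1..N. ?\<mu> (f i ` K)) \<le> (\<Sum>i=1..N. r i ^ DIM('a) * ?\<mu> K)"
    using im by (intro sum_mono measure_lipschitz_image_le contracting_similitude_lipschitz f Km)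
      (auto intro: fmeasurableD)
  also have "\<dots> = ?\<mu> K"
    unfolding sum_distrib_right[symmetric] sum1 by simp
  finally show False
    using Upos by simp
qed

lemma similarity_boundary_subset_frontier:
  fixes f :: "nat \<Rightarrow> 'a::euclidean_space \<Rightarrow> 'a"
  assumes f: "\<And>i. i \<in> {1..N} \<Longrightarrow> contracting_similitude (r i) (f i)"
    and K: "is_invariant_set N f K" and int: "interior K \<noteq> {}"
    and dim: "similarity_dimension N r = real DIM('a)"
  shows "similarity_boundary N f K \<subseteq> frontier K"
proof
  fix x assume "x \<in> similarity_boundary N f K"
  then obtain j k where jk: "j \<in> {1..N}" "k \<in> {1..N}" "j \<noteq> k" "f j x \<in> f j ` K" "f j x \<in> f k ` K"
    unfolding similarity_boundary_def by blast
  have "x \<in> K"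
    using jk(4) contracting_similitude_inj[OF f[OF jk(1)]] by (simp add: inj_image_mem_iff)
  moreover have "x \<notin> interior K"
  proof
    assume "x \<in> interior K"
    have op: "open (f i ` interior K)" if "i \<in> {1..N}" for i
      using contracting_similitude_open_image[OF f[OF that]] by blast
    have "f k ` K \<subseteq> f k ` closure (interior K)"
      using invariant_set_subset_closure_interior[OF f K int] by blast
    also have "\<dots> \<subseteq> closure (f k ` interior K)"
      by (intro image_closure_subset contracting_similitude_continuous_on[OF f[OF jk(2)]] closure_subset) simp
    finally have "f j ` interior K \<inter> closure (f k ` interior K) \<noteq> {}"
      using jk(5) \<open>x \<in> interior K\<close> by blast
    then have "f j ` interior K \<inter> f k ` interior K \<noteq> {}"
      using open_Int_closure_eq_empty[OF op[OF jk(1)]] by blast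
    moreover have "f j ` interior K \<inter> f k ` interior K = {}"
      using interior_subset[of K] op jk
      by (intro invariant_set_open_overlap_empty[OF f K dim jk(1-3)]) auto
    ultimately show False
      by blast
  qed
  ultimately show "x \<in> frontier K"
    using closure_subset[of K] by (auto simp: frontier_def)
qed

text \<open>The other pieces form a closed set missing \<open>f i x\<close>, so near
  \<open>f i x\<close> the set \<open>K\<close> coincides with piece \<open>i\<close>; pulling this
  neighbourhood back along the injective \<open>f i\<close> gives one of \<open>x\<close> inside
  \<open>K\<close>.\<close>

lemma interior_if_image_interior:
  fixes f :: "nat \<Rightarrow> 'a::euclidean_space \<Rightarrow> 'a"
  assumes f: "\<And>i. i \<in> {1..N} \<Longrightarrow> contracting_similitude (r i) (f i)"
    and K: "is_invariant_set N f K"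
    and i: "i \<in> {1..N}" and x: "x \<in> K" "x \<notin> similarity_boundary N f K"
    and fx: "f i x \<in> interior K"
  shows "x \<in> interior K"
proof -
  have "compact K" and Keq: "K = (\<Union>i\<in>{1..N}. f i ` K)"
    using K unfolding is_invariant_set_def by blast+
  let ?V = "interior K - (\<Union>k\<in>{1..N} - {i}. f k ` K)"
  have "closed (\<Union>k\<in>{1..N} - {i}. f k ` K)"
    using \<open>compact K\<close> contracting_similitude_continuous_on[OF f]
    by (auto intro!: closed_UN compact_imp_closed compact_continuous_image)
  then have "open ?V"
    by blast
  then have "open (f i -` ?V)"
    by (intro open_vimage contracting_similitude_continuous_on[OF f[OF i]])
  \<comment> \<open>As \<open>x\<close> is in \<open>K\<close>, a further piece containing
    \<open>f i x\<close> would put \<open>x\<close> in the similarity boundary.\<close>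
  moreover have "x \<in> f i -` ?V"
    using fx x i unfolding similarity_boundary_def by auto
  moreover have "f i -` ?V \<subseteq> K"
  proof
    fix y assume y: "y \<in> f i -` ?V"
    then have "f i y \<in> K"
      using interior_subset by blast
    then have "f i y \<in> (\<Union>i\<in>{1..N}. f i ` K)"
      by (rule equalityD1[OF Keq, THEN subsetD])
    then have "f i y \<in> f i ` K"
      using y by auto
    then show "y \<in> K"
      using contracting_similitude_inj[OF f[OF i]] by (simp add: inj_image_mem_iff)
  qed
  ultimately show ?thesis
    by (rule interiorI)
qed

lemma frontier_subset_similarity_boundary:
  fixes f :: "nat \<Rightarrow> 'a::euclidean_space \<Rightarrow> 'a"
  assumes f: "\<And>i. i \<in> {1..N} \<Longrightarrow> contracting_similitude (r i) (f i)"
    and K: "is_invariant_set N f K" and int: "interior K \<noteq> {}"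
    and inv: "inverse_invariant N f K (similarity_boundary N f K)"
  shows "frontier K \<subseteq> similarity_boundary N f K"
proof (rule ccontr)
  let ?S = "frontier K - similarity_boundary N f K"
  assume "\<not> frontier K \<subseteq> similarity_boundary N f K"
  then have "?S \<noteq> {}"
    by blast
  have "closed K"
    using K compact_imp_closed unfolding is_invariant_set_def by blast
  then have fr: "frontier K = K - interior K"
    by (simp add: frontier_def)
  \<comment> \<open>Inverse invariance, read contrapositively, keeps \<open>f i x\<close> off the
    similarity boundary; the previous lemma keeps it out of the interior.\<close>
  have inv_S: "f i ` ?S \<subseteq> ?S" if i: "i \<in> {1..N}" for i
    using inv i interior_if_image_interior[OF f K i] invariant_set_image_subset[OF K i]
    unfolding fr inverse_invariant_def by blast
  have "K \<subseteq> closure ?S"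
  proof (rule invariant_set_subset_forward_invariant[OF f K])
    fix i assume i: "i \<in> {1..N}"
    show "f i ` closure ?S \<subseteq> closure ?S"
      using inv_S[OF i] closure_subset[of ?S]
      by (intro image_closure_subset contracting_similitude_continuous_on[OF f[OF i]]) auto
  qed (use \<open>?S \<noteq> {}\<close> in auto)
  \<comment> \<open>The frontier is closed, so it would contain all of \<open>K\<close>, including
    its interior points.\<close>
  also have "\<dots> \<subseteq> frontier K"
    by (intro closure_minimal) auto
  finally show False
    using int interior_subset unfolding fr by blast
qed

theorem theorem3p6:
  fixes N :: nat
    and f :: "nat \<Rightarrow> real ^ 'n \<Rightarrow> real ^ 'n"
    and r :: "nat \<Rightarrow> real"
    and K :: "(real ^ 'n) set"
  assumes "\<And>i. i \<in> {1..N} \<Longrightarrow> contracting_similitude (r i) (f i)"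
    and "is_invariant_set N f K"
    and "interior K \<noteq> {}"
    and "similarity_dimension N r = real CARD('n)"
    and "inverse_invariant N f K (similarity_boundary N f K)"
  shows "similarity_boundary N f K = frontier K"
proof
  show "similarity_boundary N f K \<subseteq> frontier K"
    \<comment> \<open>The dimension of \<open>real ^ 'n\<close> as a Euclidean space is
      \<open>CARD('n)\<close>.\<close>
    using assms(4) by (intro similarity_boundary_subset_frontier[OF assms(1-3)]) auto
  show "frontier K \<subseteq> similarity_boundary N f K"
    by (rule frontier_subset_similarity_boundary[OF assms(1-3,5)])
qed

end
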